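(* Assume $0<\lambda<2$, let $d\geq 1$ be an arbitrary integer, and let $(a_n)_{n=0}^{\infty}\subset S^d$ be a greedy $\lambda$-energy sequence. For $n\ge 1$ let $U_n(x)=\sum_{k=0}^{n-1}|x-a_k|^\lambda$, $x\in S^d$. The following properties hold: 1) For every $n\geq 1$, $$U_n(a_n)\leq U_{n+1}(a_{n+1})\leq U_n(a_n)+|a_{n+1}-a_n|^\lambda.$$ 2) For every $n\geq 1$, the function $U_n$ is not constant on $S^d$. 3) For every $n\geq 1$ and $k\geq 0$, $$n\,I_\lambda(\sigma_d)<U_n(a_n)\leq n\,2^\lambda,$$ $$U_{2k+1}(a_{2k+1})=U_{2k}(a_{2k})+2^\lambda,$$ where $U_0(a_0)$ is understood to be $0$. 4) We have $$\lim_{n\to\infty}\frac{U_n(a_n)}{n}=I_\lambda(\sigma_d).$$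
   Context: $S^d=\{x\in\mathbb{R}^{d+1}:|x|=1\}$, where $|\cdot|$ is the Euclidean norm. For $\lambda>0$, a greedy $\lambda$-energy sequence on $S^d$ is a sequence $(a_n)_{n=0}^{\infty}\subset S^d$ such that $\sum_{k=0}^{n-1}|a_n-a_k|^{\lambda}=\max_{x\in S^d}\sum_{k=0}^{n-1}|x-a_k|^{\lambda}$ for all $n\geq 1$. $\sigma_d$ is the normalized uniform (rotation-invariant probability) measure on $S^d$, and $I_\lambda(\sigma_d)=\iint_{S^d\times S^d}|x-y|^\lambda\,d\sigma_d(x)\,d\sigma_d(y)$. *)

theory Defs
  imports "HOL-Probability.Probability"
begin

text \<open>
  The normalized uniform measure on the unit sphere of a Euclidean space, realised as the
  radial projection of the uniform distribution on the unit ball.  The projection \<open>sgn\<close>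
  sends \<open>x\<close> to \<open>x / |x|\<close>; it leaves the sphere only at the null set \<open>{0}\<close>, which the
  restriction discards.  That this is a rotation-invariant probability measure is shown below.
\<close>

definition sphere_measure :: "'a::euclidean_space measure" where
  "sphere_measure =
     restrict_space (distr (uniform_measure lborel (ball 0 1)) borel sgn) (sphere 0 1)"

definition riesz_energy :: "real \<Rightarrow> 'a::real_normed_vector measure \<Rightarrow> real" where
  "riesz_energy lam \<mu> = (\<integral>x. (\<integral>y. norm (x - y) powr lam \<partial>\<mu>) \<partial>\<mu>)"

definition greedy_potential :: "real \<Rightarrow> (nat \<Rightarrow> 'a::real_normed_vector) \<Rightarrow> nat \<Rightarrow> 'a \<Rightarrow> real" where
  "greedy_potential lam a n x = (\<Sum>k<n. norm (x - a k) powr lam)"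

definition greedy_energy_sequence :: "real \<Rightarrow> (nat \<Rightarrow> 'a::real_normed_vector) \<Rightarrow> bool" where
  "greedy_energy_sequence lam a \<longleftrightarrow>
     (\<forall>n. a n \<in> sphere 0 1) \<and>
     (\<forall>n\<ge>1. \<forall>x\<in>sphere 0 1. greedy_potential lam a n x \<le> greedy_potential lam a n (a n))"

lemma measurable_sgn [measurable]:
  "(sgn :: 'a::euclidean_space \<Rightarrow> 'a) \<in> borel_measurable borel"
proof -
  have "(sgn :: 'a \<Rightarrow> 'a) = (\<lambda>x. inverse (norm x) *\<^sub>R x)"
    by (auto simp: sgn_div_norm fun_eq_iff)
  then show ?thesis by simp
qed

lemma space_sphere_measure [simp]:
  "space (sphere_measure :: 'a::euclidean_space measure) = sphere 0 1"
  by (simp add: sphere_measure_def space_restrict_space)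

lemma sets_sphere_measure [simp, measurable_cong]:
  "sets (sphere_measure :: 'a::euclidean_space measure) = sets (restrict_space borel (sphere 0 1))"
  by (simp add: sphere_measure_def sets_restrict_space)

lemma emeasure_unit_ball_pos_finite:
  "emeasure lborel (ball (0::'a::euclidean_space) 1) \<noteq> 0"
  "emeasure lborel (ball (0::'a::euclidean_space) 1) \<noteq> \<infinity>"
proof -
  have "0 < measure lebesgue (ball (0::'a) 1)"
    using content_ball_pos[of 1 "0::'a"] by simp
  then show "emeasure lborel (ball (0::'a) 1) \<noteq> 0"
    by (auto simp: measure_def)
  show "emeasure lborel (ball (0::'a) 1) \<noteq> \<infinity>"
    using emeasure_bounded_finite[of "ball (0::'a) 1"] by simp
qed

lemma emeasure_sphere_measure:
  fixes A :: "'a::euclidean_space set"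
  assumes A: "A \<in> sets borel" "A \<subseteq> sphere 0 1"
  shows "emeasure sphere_measure A =
           emeasure lborel (ball 0 1 \<inter> sgn -` A) / emeasure lborel (ball (0::'a) 1)"
proof -
  have m: "sgn -` A \<in> sets (borel :: 'a measure)"
    using measurable_sets[OF measurable_sgn A(1)] by simp
  have "emeasure sphere_measure A = emeasure (distr (uniform_measure lborel (ball 0 1)) borel sgn) A"
    unfolding sphere_measure_def using A by (subst emeasure_restrict_space) auto
  also have "\<dots> = emeasure (uniform_measure lborel (ball 0 1)) (sgn -` A)"
    using A by (subst emeasure_distr) auto
  also have "\<dots> = emeasure lborel (ball 0 1 \<inter> sgn -` A) / emeasure lborel (ball (0::'a) 1)"
    using m by (subst emeasure_uniform_measure) auto
  finally show ?thesis .
qed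

lemma prob_space_sphere_measure: "prob_space (sphere_measure :: 'a::euclidean_space measure)"
proof
  have "emeasure lborel (ball 0 1 \<inter> sgn -` sphere (0::'a) 1) = emeasure lborel (ball (0::'a) 1)"
  proof (rule emeasure_eq_AE)
    show "AE x in lborel. x \<in> ball 0 1 \<inter> sgn -` sphere (0::'a) 1 \<longleftrightarrow> x \<in> ball 0 1"
      using AE_lborel_singleton[of "0::'a"] by eventually_elim (auto simp: norm_sgn)
    show "ball 0 1 \<inter> sgn -` sphere (0::'a) 1 \<in> sets lborel"
      using measurable_sets[OF measurable_sgn, of "sphere (0::'a) 1"] by auto
  qed auto
  then show "emeasure (sphere_measure :: 'a measure) (space sphere_measure) = 1"
    using emeasure_unit_ball_pos_finite[where 'a = 'a]
    by (simp add: emeasure_sphere_measure ennreal_divide_self less_top)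
qed

text \<open>
  The library proves invariance of Lebesgue measure under orthogonal maps only for index types
  that carry a well-order; here is the general case.
\<close>

lemma emeasure_lborel_orthogonal_vimage:
  fixes f :: "'a::euclidean_space \<Rightarrow> 'a"
  assumes f: "orthogonal_transformation f" and A: "A \<in> sets borel"
  shows "emeasure lborel (f -` A) = emeasure lborel A"
proof -
  have lin: "linear f" and nf: "\<And>x. norm (f x) = norm x" and "surj f"
    using f by (auto simp: orthogonal_transformation_linear orthogonal_transformation_norm
        orthogonal_transformation_surj)
  have [measurable]: "f \<in> borel_measurable borel"
    by (intro borel_measurable_continuous_onI linear_continuous_on linear_conv_bounded_linear[THEN iffD1] lin)
  note [measurable] = A
  define B where "B = ball (0::'a) 1"
  have [measurable]: "B \<in> sets borel" by (simp add: B_def)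
  define c where "c = emeasure lborel B"
  have shift: "(\<integral>\<^sup>+x. g (t + x) \<partial>lborel) = (\<integral>\<^sup>+x. g x \<partial>lborel)"
    if [measurable]: "g \<in> borel_measurable borel" for g :: "'a \<Rightarrow> ennreal" and t
    by (subst (2) lborel_distr_plus[symmetric, of t], subst nn_integral_distr) auto
  have "emeasure lborel (f -` A) * c = (\<integral>\<^sup>+x. indicator A (f x) * c \<partial>lborel)"
  proof -
    have "f -` A \<in> sets lborel" using measurable_sets[of f borel borel A] A by simp
    moreover have "indicator A (f x) = (indicator (f -` A) x :: ennreal)" for x
      by (simp add: indicator_def)
    ultimately show ?thesis by (simp add: nn_integral_multc)
  qed
  also have "\<dots> = (\<integral>\<^sup>+x. (\<integral>\<^sup>+y. indicator A (f x) * indicator B (y - f x) \<partial>lborel) \<partial>lborel)"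
  proof (intro nn_integral_cong)
    fix x
    have "c = (\<integral>\<^sup>+y. indicator B y \<partial>lborel)" by (simp add: c_def)
    also have "\<dots> = (\<integral>\<^sup>+y. indicator B (- f x + y) \<partial>lborel)"
      by (subst shift) auto
    finally show "indicator A (f x) * c = (\<integral>\<^sup>+y. indicator A (f x) * indicator B (y - f x) \<partial>lborel)"
      by (simp add: nn_integral_cmult)
  qed
  also have "\<dots> = (\<integral>\<^sup>+y. (\<integral>\<^sup>+x. indicator A (f x) * indicator B (y - f x) \<partial>lborel) \<partial>lborel)"
    by (intro lborel_pair.Fubini') measurable
  also have "\<dots> = (\<integral>\<^sup>+y. (\<integral>\<^sup>+x. indicator A (f x + y) * indicator B x \<partial>lborel) \<partial>lborel)"
  proof (rule nn_integral_cong)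
    fix y :: 'a
    obtain z where z: "y = f z" using \<open>surj f\<close> by blast
    have "(\<integral>\<^sup>+x. indicator A (f x) * indicator B (y - f x) \<partial>lborel)
        = (\<integral>\<^sup>+x. indicator A (f (z + x)) * indicator B (y - f (z + x)) \<partial>lborel :: ennreal)"
      by (subst shift[where t = z and g = "\<lambda>x. indicator A (f x) * indicator B (y - f x)"]) auto
    also have "\<dots> = (\<integral>\<^sup>+x. indicator A (f x + y) * indicator B x \<partial>lborel)"
      by (intro nn_integral_cong)
        (simp add: linear_add[OF lin] z B_def indicator_def nf add.commute)
    finally show "(\<integral>\<^sup>+x. indicator A (f x) * indicator B (y - f x) \<partial>lborel)
        = (\<integral>\<^sup>+x. indicator A (f x + y) * indicator B x \<partial>lborel :: ennreal)" .
  qed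
  also have "\<dots> = (\<integral>\<^sup>+x. (\<integral>\<^sup>+y. indicator A (f x + y) * indicator B x \<partial>lborel) \<partial>lborel)"
    by (intro lborel_pair.Fubini') measurable
  also have "\<dots> = (\<integral>\<^sup>+x. emeasure lborel A * indicator B x \<partial>lborel)"
    by (intro nn_integral_cong) (simp add: nn_integral_multc shift)
  also have "\<dots> = emeasure lborel A * c"
    by (simp add: nn_integral_cmult c_def)
  finally have "emeasure lborel (f -` A) * c = emeasure lborel A * c" .
  then have "emeasure lborel (f -` A) * c / c = emeasure lborel A * c / c" by simp
  moreover have "c \<noteq> 0" "c \<noteq> \<infinity>"
    using emeasure_unit_ball_pos_finite[where 'a = 'a] by (auto simp: c_def B_def)
  ultimately show ?thesis
    by (simp add: ennreal_mult_divide_eq)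
qed

theorem sphere_measure_rotation_invariant:
  fixes f :: "'a::euclidean_space \<Rightarrow> 'a"
  assumes f: "orthogonal_transformation f"
  shows "distr sphere_measure sphere_measure f = sphere_measure"
proof -
  have lin: "linear f" and nf: "\<And>x. norm (f x) = norm x"
    using f by (auto simp: orthogonal_transformation_linear orthogonal_transformation_norm)
  have mf: "f \<in> borel_measurable borel"
    by (intro borel_measurable_continuous_onI linear_continuous_on linear_conv_bounded_linear[THEN iffD1] lin)
  have mS: "f \<in> measurable sphere_measure sphere_measure"
  proof (subst measurable_cong_sets[OF sets_sphere_measure sets_sphere_measure],
      rule measurable_restrict_space3[OF mf])
    show "f \<in> sphere 0 1 \<rightarrow> sphere 0 1" by (auto simp: nf)
  qed
  show ?thesis
  proof (rule measure_eqI)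
    show "sets (distr sphere_measure sphere_measure f) = sets sphere_measure" by simp
    fix A assume "A \<in> sets (distr sphere_measure sphere_measure f)"
    then have As: "A \<in> sets sphere_measure" by simp
    then have A: "A \<in> sets borel" "A \<subseteq> sphere 0 1"
      by (auto simp: sets_restrict_space_iff)
    have fA: "f -` A \<inter> sphere 0 1 = f -` A" using A(2) nf by auto
    have "f -` A \<in> sets borel" using measurable_sets[OF mf A(1)] by simp
    moreover have "f -` A \<subseteq> sphere 0 1" using fA by blast
    moreover have "sgn (f x) = f (sgn x)" for x
      by (simp add: sgn_div_norm nf linear_scale[OF lin])
    then have "ball 0 1 \<inter> sgn -` (f -` A) = f -` (ball 0 1 \<inter> sgn -` A)"
      by (auto simp: nf)
    moreover have "ball 0 1 \<inter> sgn -` A \<in> sets borel"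
      using measurable_sets[OF measurable_sgn A(1)] by auto
    ultimately show "emeasure (distr sphere_measure sphere_measure f) A = emeasure sphere_measure A"
      using As A mS fA
      by (simp add: emeasure_distr emeasure_sphere_measure emeasure_lborel_orthogonal_vimage[OF f]
          del: vimage_Int)
  qed
qed

end

theory Submission
  imports Defs
begin

text \<open>
The first inequality of the first claim compares the maximum of \<open>U\<^sub>n\<^sub>+\<^sub>1\<close> with its value at \<open>a\<^sub>n\<close>, where
the newest summand vanishes; the second inequality and the bound \<open>n 2\<^sup>\<lambda>\<close> are read off from the sum.

The formula for odd indices holds because a greedy sequence consists of antipodal pairs
(\<open>greedy_potential_odd_step\<close>).  If the first \<open>2k\<close> points form such pairs, \<open>U\<^sub>2\<^sub>k\<close> is an even function,
so it is maximal at \<open>-a\<^sub>2\<^sub>k\<close> as well as at \<open>a\<^sub>2\<^sub>k\<close>.  The new summand \<open>|x - a\<^sub>2\<^sub>k|\<^sup>\<lambda>\<close> attains its maximum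
\<open>2\<^sup>\<lambda>\<close> only at \<open>-a\<^sub>2\<^sub>k\<close>, which is therefore the next point.

No \<open>U\<^sub>n\<close> with \<open>n \<ge> 1\<close> is constant (\<open>sum_norm_powr_not_constant_on_sphere\<close>): along a great circle through
\<open>a\<^sub>0\<close>, the symmetric second difference of \<open>|x - a\<^sub>0|\<^sup>\<lambda>\<close> at \<open>a\<^sub>0\<close> with step \<open>s\<close> has the order of
\<open>s\<^sup>\<lambda>\<close>, and no other summand can compensate it, since its own contribution is either nonnegative or
of order \<open>s\<^sup>2\<close>.  By rotation invariance the mean of \<open>U\<^sub>n\<close> over the sphere is \<open>n I\<close>, where \<open>I\<close> is the
energy of the uniform measure; being continuous and not constant, \<open>U\<^sub>n\<close> has a maximum above its mean.

For the limit a matching upper bound is needed.  It comes from the inequality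
\<open>\<Sum>\<^sub>i \<Sum>\<^sub>j |a\<^sub>i - a\<^sub>j|\<^sup>\<lambda> \<le> n\<^sup>2 I\<close> for any \<open>n\<close> points of the sphere (\<open>sum_norm_diff_powr_le_energy\<close>).
On the sphere the kernel is \<open>2\<^sup>p (1 - x\<bullet>y)\<^sup>p\<close> with \<open>p = \<lambda>/2 < 1\<close>, and in the binomial series of
\<open>(1 - z)\<^sup>p\<close> every coefficient except the constant one is nonpositive, while each \<open>(x\<bullet>y)\<^sup>k\<close> is a
positive definite kernel, whose energy is smallest for the uniform measure.
The left side is twice the sum of the values \<open>U\<^sub>m(a\<^sub>m)\<close> over \<open>m < n\<close>, so these values
are nondecreasing, bounded below by \<open>m I\<close>, and their partial sums are at most \<open>n\<^sup>2 I / 2\<close>.  These three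
facts determine the slope \<open>I\<close> (\<open>mono_slope_tendsto\<close>).
\<close>

section \<open>The uniform measure on the sphere\<close>

lemma measure_sphere_measure_sphere [simp]:
  "measure sphere_measure (sphere (0::'a::euclidean_space) 1) = 1"
  using prob_space.prob_space[OF prob_space_sphere_measure[where 'a = 'a]] by simp

lemma integrable_sphere_measure:
  fixes f :: "'a::euclidean_space \<Rightarrow> real"
  assumes "continuous_on (sphere 0 1) f"
  shows "integrable sphere_measure f"
proof -
  interpret prob_space "sphere_measure :: 'a measure" by (rule prob_space_sphere_measure)
  have "compact (f ` sphere 0 1)"
    using assms by (intro compact_continuous_image) auto
  then obtain B where B: "\<And>x. x \<in> sphere 0 1 \<Longrightarrow> norm (f x) \<le> B"
    by (metis (no_types, lifting) compact_imp_bounded bounded_iff imageI)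
  have "f \<in> borel_measurable sphere_measure"
    using borel_measurable_continuous_on_restrict[OF assms]
    by (simp cong: measurable_cong_sets)
  then show ?thesis
    using B by (intro integrable_const_bound[where B = B]) auto
qed

text \<open>
Rotation invariance of the measure enters only here: some orthogonal map takes \<open>e\<close> to \<open>x\<close>, and it
preserves both the inner product and the measure.
\<close>

lemma integral_sphere_zonal_eq:
  fixes x e :: "real ^ 'n" and g :: "real \<Rightarrow> real"
  assumes x: "x \<in> sphere 0 1" and e: "e \<in> sphere 0 1" and g: "continuous_on {-1..1} g"
  shows "(\<integral>y. g (x \<bullet> y) \<partial>sphere_measure) = (\<integral>y. g (e \<bullet> y) \<partial>sphere_measure)"
proof -
  obtain f where f: "orthogonal_transformation f" "f e = x"
    using orthogonal_transformation_exists_1[of e x] x e by auto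
  have nf: "norm (f y) = norm y" and lin: "linear f" for y
    using f by (auto simp: orthogonal_transformation_norm orthogonal_transformation_linear)
  have "f \<in> borel_measurable borel"
    by (intro borel_measurable_continuous_onI linear_continuous_on
        linear_conv_bounded_linear[THEN iffD1] lin)
  then have mS: "f \<in> measurable sphere_measure sphere_measure"
    by (subst measurable_cong_sets[OF sets_sphere_measure sets_sphere_measure])
      (rule measurable_restrict_space3, auto simp: nf)
  have c: "continuous_on (sphere 0 1) (\<lambda>y. g (x \<bullet> y))"
  proof (rule continuous_on_compose2[OF g])
    show "(\<lambda>y. x \<bullet> y) ` sphere 0 1 \<subseteq> {-1..1}"
      using Cauchy_Schwarz_ineq2[of x] x by (auto simp: abs_le_iff) (smt (verit))+
  qed (intro continuous_intros)
  have "(\<integral>y. g (x \<bullet> y) \<partial>sphere_measure)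
      = (\<integral>y. g (x \<bullet> y) \<partial>distr sphere_measure sphere_measure f)"
    by (simp add: sphere_measure_rotation_invariant[OF f(1)])
  also have "\<dots> = (\<integral>y. g (f e \<bullet> f y) \<partial>sphere_measure)"
    using integrable_sphere_measure[OF c] f(2)
    by (subst integral_distr[OF mS]) auto
  also have "\<dots> = (\<integral>y. g (e \<bullet> y) \<partial>sphere_measure)"
    using f(1) by (simp add: orthogonal_transformation_def)
  finally show ?thesis .
qed

text \<open>
The uniform measure has full support, because the directions in a relatively open piece of the sphere
sweep out an open cone in the ball.
\<close>

lemma emeasure_sphere_measure_open_pos:
  fixes V :: "'a::euclidean_space set"
  assumes V: "open V" and z: "z \<in> V" "z \<in> sphere 0 1"
  shows "emeasure sphere_measure (V \<inter> sphere 0 1) > 0"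
proof -
  define W where "W = sgn -` V \<inter> (ball (0::'a) 1 - {0})"
  have "continuous_on (ball (0::'a) 1 - {0}) sgn"
    by (intro continuous_on_sgn continuous_on_id) auto
  then have oW: "open W"
    unfolding W_def by (rule continuous_on_open_vimage[THEN iffD1, rule_format, rotated])
      (auto intro: V)
  have "z /\<^sub>R 2 \<in> W"
    using z by (auto simp: W_def sgn_div_norm)
  with oW have "\<not> negligible W" by (intro open_not_negligible) auto
  then have "emeasure lborel W \<noteq> 0"
    using oW by (auto simp: negligible_iff_null_sets intro: null_sets_completionI)
  moreover have "emeasure lborel W \<le> emeasure lborel (ball (0::'a) 1 \<inter> sgn -` (V \<inter> sphere 0 1))"
  proof (rule emeasure_mono)
    show "W \<subseteq> ball 0 1 \<inter> sgn -` (V \<inter> sphere 0 1)" by (auto simp: W_def norm_sgn)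
    have "sgn -` (V \<inter> sphere 0 1) \<in> sets (borel :: 'a measure)"
      using measurable_sets[OF measurable_sgn, of "V \<inter> sphere 0 1"] V by auto
    then show "ball 0 1 \<inter> sgn -` (V \<inter> sphere (0::'a) 1) \<in> sets lborel" by auto
  qed
  ultimately show ?thesis
    using V emeasure_unit_ball_pos_finite[where 'a = 'a]
    by (subst emeasure_sphere_measure)
      (auto simp: zero_less_iff_neq_zero ennreal_divide_eq_0_iff)
qed

text \<open>
If the mean of \<open>f\<close> were equal to the bound \<open>M\<close>, then \<open>f = M\<close> almost everywhere; by continuity \<open>f < M\<close>
holds on a relatively open set, which has positive measure.
\<close>

lemma integral_sphere_measure_less:
  fixes f :: "'a::euclidean_space \<Rightarrow> real"
  assumes f: "continuous_on (sphere 0 1) f" and le: "\<And>x. x \<in> sphere 0 1 \<Longrightarrow> f x \<le> M"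
    and z: "z \<in> sphere 0 1" "f z < M"
  shows "(\<integral>x. f x \<partial>sphere_measure) < M"
proof (rule ccontr)
  assume ge: "\<not> (\<integral>x. f x \<partial>sphere_measure) < M"
  interpret prob_space "sphere_measure :: 'a measure" by (rule prob_space_sphere_measure)
  note int = integrable_sphere_measure[OF f]
  have "(\<integral>x. M - f x \<partial>sphere_measure) = M - (\<integral>x. f x \<partial>sphere_measure)"
    using int by simp
  moreover have "(\<integral>x. M - f x \<partial>sphere_measure) \<ge> 0"
    using le by (intro integral_nonneg_AE) auto
  ultimately have "(\<integral>x. M - f x \<partial>sphere_measure) = 0"
    using ge by simp
  then have ae: "AE x in sphere_measure. M - f x = 0"
    using int le by (subst (asm) integral_nonneg_eq_0_iff_AE) auto
  obtain V where V: "open V" "V \<inter> sphere 0 1 = f -` {..<M} \<inter> sphere 0 1"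
    using f unfolding continuous_on_open_invariant by (metis open_lessThan)
  have sV: "V \<inter> sphere 0 1 \<in> sets sphere_measure"
    using V(1) by (auto simp: sets_restrict_space)
  have "AE x in sphere_measure. x \<notin> V \<inter> sphere 0 1"
    using ae by eventually_elim (use V(2) in auto)
  then have "emeasure sphere_measure (V \<inter> sphere 0 1) = 0"
    using sV by (subst (asm) AE_iff_measurable[OF sV])
      (auto dest: sets.sets_into_space)
  moreover have "z \<in> V" using z V(2) by blast
  ultimately show False
    using emeasure_sphere_measure_open_pos[OF V(1)] z by fastforce
qed

section \<open>The energy of finite point sets\<close>

lemma norm_diff_unit_powr:
  fixes x y :: "'a::real_inner"
  assumes "norm x = 1" "norm y = 1"
  shows "norm (x - y) powr lam = (2 - 2 * (x \<bullet> y)) powr (lam / 2)"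
proof -
  have "(norm (x - y))\<^sup>2 = 2 - 2 * (x \<bullet> y)"
    using assms by (simp add: power2_norm_eq_inner inner_diff inner_commute norm_eq_1)
  then have "2 - 2 * (x \<bullet> y) = norm (x - y) powr 2"
    by (simp flip: powr_numeral)
  then show ?thesis by (simp only: powr_powr) simp
qed

lemma abs_inner_sphere_le_1:
  assumes "x \<in> sphere 0 1" "y \<in> sphere (0::'a::real_inner) 1"
  shows "\<bar>x \<bullet> y\<bar> \<le> 1"
  using assms Cauchy_Schwarz_ineq2[of x y] by simp

text \<open>
The map taking \<open>x\<close> to the family of its degree \<open>k\<close> monomials, indexed by the words \<open>\<alpha>\<close> of length \<open>k\<close> in
the basis vectors, is the tensor power \<open>x\<^sup>\<otimes>\<^sup>k\<close>.  It realises \<open>(x \<bullet> y)\<^sup>k\<close> as an inner product and so shows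
that this kernel is positive definite.
\<close>

lemma inner_power_eq_sum_PiE:
  fixes x y :: "'a::euclidean_space"
  shows "(x \<bullet> y) ^ k = (\<Sum>\<alpha>\<in>{..<k} \<rightarrow>\<^sub>E Basis. (\<Prod>i<k. x \<bullet> \<alpha> i) * (\<Prod>i<k. y \<bullet> \<alpha> i))"
proof -
  have "(x \<bullet> y) ^ k = (\<Prod>i<k. \<Sum>b\<in>Basis. (x \<bullet> b) * (y \<bullet> b))"
    by (simp flip: euclidean_inner)
  also have "\<dots> = (\<Sum>\<alpha>\<in>{..<k} \<rightarrow>\<^sub>E Basis. \<Prod>i<k. (x \<bullet> \<alpha> i) * (y \<bullet> \<alpha> i))"
    by (rule prod_sum_PiE) auto
  finally show ?thesis by (simp add: prod.distrib)
qed

text \<open>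
The quadratic form of the positive definite kernel \<open>(x \<bullet> y)\<^sup>k\<close> is applied to the signed measure
\<open>\<Sum>\<^sub>i \<delta>\<^bsub>a i\<^esub> - n \<sigma>\<close>, where \<open>\<sigma>\<close> is the uniform measure.  Both the mixed terms and the self-energy of \<open>\<sigma>\<close>
reduce to the moment \<open>\<integral> (e \<bullet> y)\<^sup>k\<close>, which by rotation invariance is the same for all \<open>e\<close>.
\<close>

lemma sum_inner_power_ge:
  fixes a :: "nat \<Rightarrow> real ^ 'n" and e :: "real ^ 'n"
  assumes a: "\<And>i. a i \<in> sphere 0 1" and e: "e \<in> sphere 0 1"
  shows "(real n)\<^sup>2 * (\<integral>y. (e \<bullet> y) ^ k \<partial>sphere_measure) \<le> (\<Sum>i<n. \<Sum>j<n. (a i \<bullet> a j) ^ k)"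
proof -
  interpret prob_space "sphere_measure :: (real ^ 'n) measure" by (rule prob_space_sphere_measure)
  define m where "m = (\<integral>y. (e \<bullet> y) ^ k \<partial>sphere_measure)"
  define P where "P = ({..<k} \<rightarrow>\<^sub>E (Basis :: (real ^ 'n) set))"
  define \<phi> where "\<phi> \<alpha> x = (\<Prod>i<k. x \<bullet> \<alpha> i)" for \<alpha> and x :: "real ^ 'n"
  define M where "M \<alpha> = (\<integral>y. \<phi> \<alpha> y \<partial>sphere_measure)" for \<alpha>
  define S where "S \<alpha> = (\<Sum>i<n. \<phi> \<alpha> (a i))" for \<alpha>
  have pw: "(x \<bullet> y) ^ k = (\<Sum>\<alpha>\<in>P. \<phi> \<alpha> x * \<phi> \<alpha> y)" for x y
    unfolding P_def \<phi>_def by (rule inner_power_eq_sum_PiE)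
  have int: "integrable sphere_measure (\<phi> \<alpha>)" for \<alpha>
    unfolding \<phi>_def by (intro integrable_sphere_measure continuous_intros)
  have m: "(\<Sum>\<alpha>\<in>P. \<phi> \<alpha> x * M \<alpha>) = m" if "x \<in> sphere 0 1" for x
  proof -
    have "m = (\<integral>y. (x \<bullet> y) ^ k \<partial>sphere_measure)"
      unfolding m_def using e that
      by (intro integral_sphere_zonal_eq[where g = "\<lambda>t. t ^ k"]) (auto intro!: continuous_intros)
    also have "\<dots> = (\<Sum>\<alpha>\<in>P. \<phi> \<alpha> x * M \<alpha>)"
      unfolding pw M_def using int by (subst Bochner_Integration.integral_sum) auto
    finally show ?thesis by simp
  qed
  have MM: "(\<Sum>\<alpha>\<in>P. M \<alpha> * M \<alpha>) = m"
  proof -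
    have "(\<Sum>\<alpha>\<in>P. M \<alpha> * M \<alpha>) = (\<integral>x. (\<Sum>\<alpha>\<in>P. \<phi> \<alpha> x * M \<alpha>) \<partial>sphere_measure)"
      using int by (subst Bochner_Integration.integral_sum) (auto simp: M_def)
    also have "\<dots> = (\<integral>x. m \<partial>(sphere_measure :: (real ^ 'n) measure))"
      by (intro Bochner_Integration.integral_cong) (simp_all add: m)
    finally show ?thesis by simp
  qed
  have SM: "(\<Sum>\<alpha>\<in>P. S \<alpha> * M \<alpha>) = real n * m"
  proof -
    have "(\<Sum>\<alpha>\<in>P. S \<alpha> * M \<alpha>) = (\<Sum>i<n. \<Sum>\<alpha>\<in>P. \<phi> \<alpha> (a i) * M \<alpha>)"
      unfolding S_def sum_distrib_right by (rule sum.swap)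
    then show ?thesis using a by (simp add: m)
  qed
  have SS: "(\<Sum>\<alpha>\<in>P. S \<alpha> * S \<alpha>) = (\<Sum>i<n. \<Sum>j<n. (a i \<bullet> a j) ^ k)"
  proof -
    have "(\<Sum>\<alpha>\<in>P. S \<alpha> * S \<alpha>) = (\<Sum>\<alpha>\<in>P. \<Sum>i<n. \<Sum>j<n. \<phi> \<alpha> (a i) * \<phi> \<alpha> (a j))"
      by (simp add: S_def sum_product)
    also have "\<dots> = (\<Sum>i<n. \<Sum>\<alpha>\<in>P. \<Sum>j<n. \<phi> \<alpha> (a i) * \<phi> \<alpha> (a j))" by (rule sum.swap)
    also have "\<dots> = (\<Sum>i<n. \<Sum>j<n. \<Sum>\<alpha>\<in>P. \<phi> \<alpha> (a i) * \<phi> \<alpha> (a j))"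
      by (intro sum.cong sum.swap refl)
    finally show ?thesis by (simp add: pw)
  qed
  have "0 \<le> (\<Sum>\<alpha>\<in>P. (S \<alpha> - real n * M \<alpha>)\<^sup>2)" by (intro sum_nonneg) auto
  also have "\<dots> = (\<Sum>\<alpha>\<in>P. S \<alpha> * S \<alpha> - 2 * real n * (S \<alpha> * M \<alpha>) + (real n)\<^sup>2 * (M \<alpha> * M \<alpha>))"
    by (intro sum.cong) (auto simp: power2_eq_square algebra_simps)
  also have "\<dots> = (\<Sum>\<alpha>\<in>P. S \<alpha> * S \<alpha>) - 2 * real n * (\<Sum>\<alpha>\<in>P. S \<alpha> * M \<alpha>)
      + (real n)\<^sup>2 * (\<Sum>\<alpha>\<in>P. M \<alpha> * M \<alpha>)"
    by (simp add: sum.distrib sum_subtractf sum_distrib_left)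
  also have "\<dots> = (\<Sum>i<n. \<Sum>j<n. (a i \<bullet> a j) ^ k) - (real n)\<^sup>2 * m"
    by (simp add: SS SM MM power2_eq_square)
  finally show ?thesis by (simp add: m_def)
qed

text \<open>
For \<open>k \<ge> 1\<close> the coefficients of the binomial series of \<open>(1 - r z)\<^sup>p\<close> are nonpositive, so the preceding lower
bounds for the power kernels become an upper bound after summation.  The factor \<open>r < 1\<close> gives uniform
convergence for \<open>|z| \<le> 1\<close>, which permits integration term by term.
\<close>

lemma sum_powr_inner_le_shrunk:
  fixes a :: "nat \<Rightarrow> real ^ 'n" and e :: "real ^ 'n"
  assumes p: "0 < p" "p < 1" and r: "0 \<le> r" "r < 1"
    and a: "\<And>i. a i \<in> sphere 0 1" and e: "e \<in> sphere 0 1"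
  shows "(\<Sum>i<n. \<Sum>j<n. (1 - r * (a i \<bullet> a j)) powr p)
      \<le> (real n)\<^sup>2 * (\<integral>y. (1 - r * (e \<bullet> y)) powr p \<partial>sphere_measure)"
proof -
  interpret prob_space "sphere_measure :: (real ^ 'n) measure" by (rule prob_space_sphere_measure)
  define c where "c k = pochhammer (- p) k / fact k * r ^ k" for k
  \<comment> \<open>Of the factors of the Pochhammer symbol of \<open>-p\<close> only the first is negative.\<close>
  have c: "c k \<le> 0" if "k \<noteq> 0" for k
  proof -
    obtain l where k: "k = Suc l" using \<open>k \<noteq> 0\<close> not0_implies_Suc by blast
    have "pochhammer (1 - p) l \<ge> 0" using p by (intro pochhammer_nonneg) auto
    then have "pochhammer (- p) k \<le> 0"
      using p by (simp add: k pochhammer_rec mult_nonpos_nonneg)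
    then show ?thesis using r
      unfolding c_def by (intro mult_nonpos_nonneg divide_nonpos_pos) auto
  qed
  have sums: "(\<lambda>k. c k * z ^ k) sums (1 - r * z) powr p" if z: "\<bar>z\<bar> \<le> 1" for z
  proof -
    have "\<bar>- (r * z)\<bar> \<le> r * 1" using r z by (simp add: abs_mult mult_left_le)
    then have "(\<lambda>k. (p gchoose k) * (- (r * z)) ^ k) sums (1 + - (r * z)) powr p"
      using r by (intro gen_binomial_real) auto
    moreover have "(p gchoose k) * (- (r * z)) ^ k = c k * z ^ k" for k
      by (simp add: c_def gbinomial_pochhammer power_minus[of "r * z"] power_mult_distrib)
    ultimately show ?thesis by simp
  qed
  have "summable c" using sums[of 1] by (simp add: sums_iff)
  then have "summable (\<lambda>k. - c k)" by (rule summable_minus)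
  then have abs_c: "summable (\<lambda>k. \<bar>c k\<bar>)"
    by (rule summable_comparison_test'[of _ 1]) (use c in auto)
  have cz: "\<bar>c k * z ^ k\<bar> \<le> \<bar>c k\<bar>" if "\<bar>z\<bar> \<le> 1" for k z
    using that by (simp add: abs_mult power_abs mult_left_le power_le_one)
  have ey: "\<bar>e \<bullet> y\<bar> \<le> 1" if "y \<in> sphere 0 1" for y
    using abs_inner_sphere_le_1[OF e that] .
  have int: "integrable sphere_measure (\<lambda>y. c k * (e \<bullet> y) ^ k)" for k
    by (intro integrable_sphere_measure continuous_intros)
  have "(\<lambda>k. \<integral>y. c k * (e \<bullet> y) ^ k \<partial>sphere_measure) sums
      (\<integral>y. (\<Sum>k. c k * (e \<bullet> y) ^ k) \<partial>sphere_measure)"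
  proof (rule sums_integral[OF int])
    show "AE y in sphere_measure. summable (\<lambda>k. norm (c k * (e \<bullet> y) ^ k))"
      using ey cz by (intro AE_I2 summable_comparison_test'[OF abs_c, of 0]) auto
    show "summable (\<lambda>k. \<integral>y. norm (c k * (e \<bullet> y) ^ k) \<partial>sphere_measure)"
    proof (rule summable_comparison_test'[OF abs_c, of 0])
      fix k
      have "(\<integral>y. norm (c k * (e \<bullet> y) ^ k) \<partial>sphere_measure) \<le> \<bar>c k\<bar>"
        using ey cz int by (intro integral_le_const AE_I2 integrable_norm) auto
      then show "norm (\<integral>y. norm (c k * (e \<bullet> y) ^ k) \<partial>sphere_measure) \<le> \<bar>c k\<bar>"
        by (simp add: integral_nonneg_AE)
    qed
  qed
  also have "(\<integral>y. (\<Sum>k. c k * (e \<bullet> y) ^ k) \<partial>sphere_measure)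
      = (\<integral>y. (1 - r * (e \<bullet> y)) powr p \<partial>sphere_measure)"
    by (intro Bochner_Integration.integral_cong) (use sums ey in \<open>auto simp: sums_iff\<close>)
  finally have right: "(\<lambda>k. (real n)\<^sup>2 * (\<integral>y. c k * (e \<bullet> y) ^ k \<partial>sphere_measure)) sums
      ((real n)\<^sup>2 * (\<integral>y. (1 - r * (e \<bullet> y)) powr p \<partial>sphere_measure))"
    by (rule sums_mult)
  have left: "(\<lambda>k. \<Sum>i<n. \<Sum>j<n. c k * (a i \<bullet> a j) ^ k) sums
      (\<Sum>i<n. \<Sum>j<n. (1 - r * (a i \<bullet> a j)) powr p)"
    using a by (intro sums_sum sums abs_inner_sphere_le_1)
  show ?thesis
  proof (rule sums_le[OF _ left right])
    fix k
    have "c k * (\<Sum>i<n. \<Sum>j<n. (a i \<bullet> a j) ^ k)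
        \<le> c k * ((real n)\<^sup>2 * (\<integral>y. (e \<bullet> y) ^ k \<partial>sphere_measure))"
    proof (cases "k = 0")
      case True
      then show ?thesis by (simp add: power2_eq_square)
    next
      case False
      then show ?thesis using c sum_inner_power_ge[OF a e] by (intro mult_left_mono_neg) auto
    qed
    then show "(\<Sum>i<n. \<Sum>j<n. c k * (a i \<bullet> a j) ^ k)
        \<le> (real n)\<^sup>2 * (\<integral>y. c k * (e \<bullet> y) ^ k \<partial>sphere_measure)"
      by (simp add: sum_distrib_left mult_ac)
  qed
qed

text \<open>
The case \<open>r = 1\<close> follows by dominated convergence as \<open>r\<close> tends to \<open>1\<close>.
\<close>

lemma sum_powr_inner_le:
  fixes a :: "nat \<Rightarrow> real ^ 'n" and e :: "real ^ 'n"
  assumes p: "0 < p" "p < 1" and a: "\<And>i. a i \<in> sphere 0 1" and e: "e \<in> sphere 0 1"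
  shows "(\<Sum>i<n. \<Sum>j<n. (1 - a i \<bullet> a j) powr p)
      \<le> (real n)\<^sup>2 * (\<integral>y. (1 - e \<bullet> y) powr p \<partial>sphere_measure)"
proof -
  interpret prob_space "sphere_measure :: (real ^ 'n) measure" by (rule prob_space_sphere_measure)
  define r where "r m = 1 - inverse (real (Suc m))" for m
  have r: "0 \<le> r m" "r m < 1" for m by (auto simp: r_def field_simps)
  have "r \<longlonglongrightarrow> 1 - 0" unfolding r_def by (intro tendsto_intros LIMSEQ_inverse_real_of_nat)
  then have r_lim: "r \<longlonglongrightarrow> 1" by simp
  have rz: "\<bar>r m * z\<bar> \<le> 1" if "\<bar>z\<bar> \<le> 1" for m z
    using mult_mono[of "r m" 1 "\<bar>z\<bar>" 1] r[of m] that by (simp add: abs_mult)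
  have lim: "(\<lambda>m. (1 - r m * z) powr p) \<longlonglongrightarrow> (1 - z) powr p" if "\<bar>z\<bar> \<le> 1" for z
  proof -
    have "(\<lambda>m. (1 - r m * z) powr p) \<longlonglongrightarrow> (1 - 1 * z) powr p"
      using p rz[OF that] by (intro tendsto_powr' tendsto_intros r_lim) (auto simp: abs_le_iff)
    then show ?thesis by simp
  qed
  have cont: "continuous_on (sphere 0 1) (\<lambda>y. (1 - t * (e \<bullet> y)) powr p)" if "0 \<le> t" "t \<le> 1" for t
  proof (intro continuous_on_powr' continuous_intros ballI)
    fix y :: "real ^ 'n" assume y: "y \<in> sphere 0 1"
    have "t * (e \<bullet> y) \<le> 1"
      using mult_mono[of t 1 "\<bar>e \<bullet> y\<bar>" 1] that abs_inner_sphere_le_1[OF e y]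
        mult_left_mono[OF abs_ge_self[of "e \<bullet> y"], of t] by simp
    then show "0 \<le> 1 - t * (e \<bullet> y) \<and> (1 - t * (e \<bullet> y) = 0 \<longrightarrow> 0 < p)" using p by simp
  qed
  have "(\<lambda>m. \<integral>y. (1 - r m * (e \<bullet> y)) powr p \<partial>sphere_measure)
      \<longlonglongrightarrow> (\<integral>y. (1 - e \<bullet> y) powr p \<partial>sphere_measure)"
  proof (rule integral_dominated_convergence[where w = "\<lambda>_. 2 powr p"])
    show "(\<lambda>y. (1 - e \<bullet> y) powr p) \<in> borel_measurable sphere_measure"
      using integrable_sphere_measure[OF cont[of 1]] by auto
    show "(\<lambda>y. (1 - r m * (e \<bullet> y)) powr p) \<in> borel_measurable sphere_measure" for m
      using integrable_sphere_measure[OF cont[of "r m"]] r[of m] by auto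
    show "AE y in sphere_measure. (\<lambda>m. (1 - r m * (e \<bullet> y)) powr p) \<longlonglongrightarrow> (1 - e \<bullet> y) powr p"
      using lim abs_inner_sphere_le_1[OF e] by (intro AE_I2) simp
    show "AE y in sphere_measure. norm ((1 - r m * (e \<bullet> y)) powr p) \<le> 2 powr p" for m
    proof (intro AE_I2)
      fix y :: "real ^ 'n" assume "y \<in> space sphere_measure"
      then have "\<bar>r m * (e \<bullet> y)\<bar> \<le> 1" using rz abs_inner_sphere_le_1[OF e] by simp
      then show "norm ((1 - r m * (e \<bullet> y)) powr p) \<le> 2 powr p"
        using p by (auto simp: abs_le_iff intro!: powr_mono2)
    qed
  qed simp
  then have right: "(\<lambda>m. (real n)\<^sup>2 * (\<integral>y. (1 - r m * (e \<bullet> y)) powr p \<partial>sphere_measure))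
      \<longlonglongrightarrow> (real n)\<^sup>2 * (\<integral>y. (1 - e \<bullet> y) powr p \<partial>sphere_measure)"
    by (intro tendsto_intros)
  have left: "(\<lambda>m. \<Sum>i<n. \<Sum>j<n. (1 - r m * (a i \<bullet> a j)) powr p)
      \<longlonglongrightarrow> (\<Sum>i<n. \<Sum>j<n. (1 - a i \<bullet> a j) powr p)"
    using a by (intro tendsto_sum lim abs_inner_sphere_le_1)
  show ?thesis
    using sum_powr_inner_le_shrunk[OF p r a e] by (intro LIMSEQ_le[OF left right]) auto
qed

lemma continuous_on_norm_diff_powr:
  assumes "0 < lam"
  shows "continuous_on S (\<lambda>x::'a::real_normed_vector. norm (x - b) powr lam)"
  using assms by (intro continuous_on_powr' continuous_intros) auto

lemma integral_norm_diff_powr_eq: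
  fixes x :: "real ^ 'n"
  assumes lam: "0 < lam" and x: "x \<in> sphere 0 1"
  shows "(\<integral>y. norm (y - x) powr lam \<partial>sphere_measure) = riesz_energy lam (sphere_measure :: (real ^ 'n) measure)"
proof -
  interpret prob_space "sphere_measure :: (real ^ 'n) measure" by (rule prob_space_sphere_measure)
  have pot: "(\<integral>y. norm (z - y) powr lam \<partial>sphere_measure)
      = (\<integral>y. (2 - 2 * (z \<bullet> y)) powr (lam / 2) \<partial>sphere_measure)" if "z \<in> sphere 0 1" for z :: "real ^ 'n"
    by (intro Bochner_Integration.integral_cong) (use that in \<open>auto simp: norm_diff_unit_powr\<close>)
  have const: "(\<integral>y. norm (z - y) powr lam \<partial>sphere_measure) = (\<integral>y. norm (x - y) powr lam \<partial>sphere_measure)"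
    if "z \<in> sphere 0 1" for z :: "real ^ 'n"
    unfolding pot[OF that] pot[OF x] using that x lam
    by (intro integral_sphere_zonal_eq[where g = "\<lambda>t. (2 - 2 * t) powr (lam / 2)"]
        continuous_on_powr' continuous_intros) auto
  have "riesz_energy lam (sphere_measure :: (real ^ 'n) measure)
      = (\<integral>z. (\<integral>y. norm (x - y) powr lam \<partial>sphere_measure) \<partial>(sphere_measure :: (real ^ 'n) measure))"
    unfolding riesz_energy_def
    by (rule Bochner_Integration.integral_cong) (use const in auto)
  then show ?thesis by (simp add: norm_minus_commute)
qed

text \<open>
Among all probability measures on the sphere the uniform one has the largest energy for exponents
between \<open>0\<close> and \<open>2\<close>; this is the case of the equal-weight measure on finitely many points, multiplied by
\<open>n\<^sup>2\<close>.
\<close>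

lemma sum_norm_diff_powr_le_energy:
  fixes a :: "nat \<Rightarrow> real ^ 'n"
  assumes lam: "0 < lam" "lam < 2" and a: "\<And>i. a i \<in> sphere 0 1"
  shows "(\<Sum>i<n. \<Sum>j<n. norm (a i - a j) powr lam)
      \<le> (real n)\<^sup>2 * riesz_energy lam (sphere_measure :: (real ^ 'n) measure)"
proof -
  define p where "p = lam / 2"
  have p: "0 < p" "p < 1" using lam by (auto simp: p_def)
  have K: "norm (x - y) powr lam = 2 powr p * (1 - x \<bullet> y) powr p"
    if "x \<in> sphere 0 1" "y \<in> sphere 0 1" for x y :: "real ^ 'n"
  proof -
    have "2 - 2 * (x \<bullet> y) = 2 * (1 - x \<bullet> y)" by simp
    then show ?thesis using that abs_inner_sphere_le_1[OF that]
      by (simp add: norm_diff_unit_powr p_def powr_mult del: right_diff_distrib_numeral)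
  qed
  have "riesz_energy lam (sphere_measure :: (real ^ 'n) measure)
      = (\<integral>y. 2 powr p * (1 - a 0 \<bullet> y) powr p \<partial>sphere_measure)"
    unfolding integral_norm_diff_powr_eq[OF lam(1) a[of 0], symmetric]
    by (intro Bochner_Integration.integral_cong) (use a[of 0] in \<open>auto simp: K inner_commute\<close>)
  then have "riesz_energy lam (sphere_measure :: (real ^ 'n) measure)
      = 2 powr p * (\<integral>y. (1 - a 0 \<bullet> y) powr p \<partial>sphere_measure)"
    by simp
  moreover have "(\<Sum>i<n. \<Sum>j<n. norm (a i - a j) powr lam)
      = 2 powr p * (\<Sum>i<n. \<Sum>j<n. (1 - a i \<bullet> a j) powr p)"
    using a by (simp add: K sum_distrib_left)
  ultimately show ?thesis
    using mult_left_mono[OF sum_powr_inner_le[OF p a a[of 0], where n = n], of "2 powr p"]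
    by (simp add: mult_ac)
qed

section \<open>The cusp of a finite potential\<close>

text \<open>
In terms of \<open>s = t / t\<^sub>0\<close> the claim is \<open>(2 - p) s \<le> s\<^sup>p + (1 - p) s\<^sup>2\<close>.  This is Young's inequality: with
weights \<open>1 / (2 - p)\<close> and \<open>(1 - p) / (2 - p)\<close> the geometric mean of \<open>s\<^sup>p\<close> and \<open>s\<^sup>2\<close> is \<open>s\<close>.  The linear part is the
tangent at \<open>t\<^sub>0\<close>, which lies above the concave power function; the quadratic term corrects for this.
\<close>

lemma powr_ge_quadratic:
  fixes p t t0 :: real
  assumes p: "0 < p" "p < 1" and t: "0 \<le> t" "0 < t0"
  shows "t powr p \<ge> t0 powr p * (1 + p * ((t - t0) / t0) - (1 - p) * ((t - t0) / t0)\<^sup>2)"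
proof (cases "t = 0")
  case True
  then show ?thesis using p t by (simp add: power2_eq_square)
next
  case False
  define s where "s = t / t0"
  have s: "s > 0" using False t by (simp add: s_def)
  have "(s powr p) powr (1 / (2 - p)) * (s\<^sup>2) powr ((1 - p) / (2 - p))
      \<le> 1 / (2 - p) * s powr p + (1 - p) / (2 - p) * s\<^sup>2"
    using p s by (intro Youngs_inequality_0) (auto simp: field_simps)
  also have "(s powr p) powr (1 / (2 - p)) * (s\<^sup>2) powr ((1 - p) / (2 - p))
      = s powr (p * (1 / (2 - p)) + 2 * ((1 - p) / (2 - p)))"
    using s by (simp add: powr_powr powr_add flip: powr_numeral)
  also have "p * (1 / (2 - p)) + 2 * ((1 - p) / (2 - p)) = (p + 2 * (1 - p)) / (2 - p)"
    by (simp only: add_divide_distrib times_divide_eq_right mult_1_right)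
  also have "\<dots> = 1" using p by simp
  also have "1 / (2 - p) * s powr p + (1 - p) / (2 - p) * s\<^sup>2 = (s powr p + (1 - p) * s\<^sup>2) / (2 - p)"
    by (simp add: add_divide_distrib)
  finally have "(2 - p) * s \<le> s powr p + (1 - p) * s\<^sup>2"
    using p s by (simp add: pos_le_divide_eq mult.commute)
  then have *: "s powr p \<ge> 1 + p * (s - 1) - (1 - p) * (s - 1)\<^sup>2"
    by (simp add: power2_eq_square algebra_simps)
  have "(t - t0) / t0 = s - 1" "t powr p = t0 powr p * s powr p"
    using t False by (auto simp: s_def field_simps powr_divide)
  then show ?thesis using * by (simp add: mult_left_mono)
qed

text \<open>
When the bounds of the preceding lemma at \<open>tp\<close> and \<open>tm\<close> are added, the linear parts combine to a multiple of
\<open>tp + tm - 2 t\<^sub>0\<close>, which is bounded below to second order in \<open>s\<close>.  The values \<open>tp\<close> and \<open>tm\<close> stand for squared distances to a fixed point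
from two points symmetric about a centre, and \<open>t\<^sub>0\<close> for the squared distance from the centre.
\<close>

lemma powr_second_difference_ge:
  fixes p s t0 tp tm :: real
  assumes p: "0 < p" "p < 1" and t: "0 < t0" "0 \<le> tp" "0 \<le> tm"
    and near: "\<bar>tp - t0\<bar> \<le> 4 * s" "\<bar>tm - t0\<bar> \<le> 4 * s" and sum: "tp + tm - 2 * t0 \<ge> - 4 * s\<^sup>2"
  shows "tp powr p + tm powr p - 2 * t0 powr p \<ge> - (t0 powr p * (4 / t0 + 32 / t0\<^sup>2)) * s\<^sup>2"
proof -
  define u w where "u = (tp - t0) / t0" and "w = (tm - t0) / t0"
  have "u + w = (tp + tm - 2 * t0) / t0" using t by (simp add: u_def w_def field_simps)
  then have "u + w \<ge> - 4 * s\<^sup>2 / t0" using divide_right_mono[OF sum, of t0] t by simp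
  then have "p * (u + w) \<ge> p * (- 4 * s\<^sup>2 / t0)" using p by (intro mult_left_mono) auto
  moreover have "p * (4 * s\<^sup>2 / t0) \<le> 1 * (4 * s\<^sup>2 / t0)"
    using p t by (intro mult_right_mono) auto
  ultimately have 1: "p * (u + w) \<ge> - 4 * s\<^sup>2 / t0" by linarith
  have sq: "(1 - p) * ((y - t0) / t0)\<^sup>2 \<le> 16 * s\<^sup>2 / t0\<^sup>2" if "\<bar>y - t0\<bar> \<le> 4 * s" for y
  proof -
    have "(y - t0)\<^sup>2 \<le> (4 * s)\<^sup>2" using that by (intro power2_le_iff_abs_le[THEN iffD2]) auto
    then have "((y - t0) / t0)\<^sup>2 \<le> 16 * s\<^sup>2 / t0\<^sup>2"
      by (simp add: power_divide power_mult_distrib divide_right_mono)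
    moreover have "(1 - p) * ((y - t0) / t0)\<^sup>2 \<le> 1 * ((y - t0) / t0)\<^sup>2"
      using p by (intro mult_right_mono) auto
    ultimately show ?thesis by linarith
  qed
  have "t0 powr p * (- (4 / t0 + 32 / t0\<^sup>2) * s\<^sup>2)
      \<le> t0 powr p * (p * (u + w) - (1 - p) * u\<^sup>2 - (1 - p) * w\<^sup>2)"
  proof (intro mult_left_mono)
    have "- (4 / t0 + 32 / t0\<^sup>2) * s\<^sup>2 = - 4 * s\<^sup>2 / t0 - 16 * s\<^sup>2 / t0\<^sup>2 - 16 * s\<^sup>2 / t0\<^sup>2"
      by (simp add: algebra_simps)
    also have "\<dots> \<le> p * (u + w) - (1 - p) * u\<^sup>2 - (1 - p) * w\<^sup>2"
      using 1 sq[OF near(1)] sq[OF near(2)] unfolding u_def w_def by linarith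
    finally show "- (4 / t0 + 32 / t0\<^sup>2) * s\<^sup>2 \<le> p * (u + w) - (1 - p) * u\<^sup>2 - (1 - p) * w\<^sup>2" .
  qed simp
  then show ?thesis
    using powr_ge_quadratic[OF p t(2,1)] powr_ge_quadratic[OF p t(3,1)]
    unfolding u_def[symmetric] w_def[symmetric] by (simp add: algebra_simps)
qed

text \<open>
Suppose that the potential is constant.  On the great circle through \<open>e = a i0\<close> in the direction of a unit
vector \<open>v\<close> orthogonal to \<open>e\<close>, its symmetric second difference at \<open>e\<close> vanishes.  The summands centred at \<open>e\<close>
contribute at least \<open>2 s\<^sup>\<lambda>\<close>, and those centred elsewhere at least \<open>-C s\<^sup>2\<close>.  Hence \<open>2 \<le> B s\<^bsup>2 - \<lambda>\<^esup>\<close> for all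
small \<open>s\<close> and a constant \<open>B\<close>, which fails as \<open>s\<close> tends to \<open>0\<close> since \<open>\<lambda> < 2\<close>.
\<close>

lemma sum_norm_powr_not_constant_on_sphere:
  fixes a :: "'i \<Rightarrow> 'a::euclidean_space"
  assumes lam: "0 < lam" "lam < 2" and dim: "DIM('a) \<ge> 2"
    and fin: "finite K" "i0 \<in> K" and a: "\<And>k. k \<in> K \<Longrightarrow> a k \<in> sphere 0 1"
  shows "\<not> (\<lambda>x. \<Sum>k\<in>K. norm (x - a k) powr lam) constant_on sphere 0 1"
proof
  define p where "p = lam / 2"
  have p: "0 < p" "p < 1" using lam by (auto simp: p_def)
  assume "(\<lambda>x. \<Sum>k\<in>K. norm (x - a k) powr lam) constant_on sphere 0 1"
  then obtain c where c: "\<And>x. norm x = 1 \<Longrightarrow> (\<Sum>k\<in>K. norm (x - a k) powr lam) = c"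
    by (auto simp: constant_on_def)
  define e where "e = a i0"
  have e: "norm e = 1" using a[OF fin(2)] by (simp add: e_def)
  obtain v0 where "v0 \<noteq> 0" "orthogonal e v0"
    using orthogonal_to_vector_exists[OF dim] by blast
  define v where "v = sgn v0"
  have v: "norm v = 1" "e \<bullet> v = 0"
    using \<open>v0 \<noteq> 0\<close> \<open>orthogonal e v0\<close> by (auto simp: v_def norm_sgn sgn_div_norm orthogonal_def)
  \<comment> \<open>\<open>s\<close> is the sine of the angle from \<open>e\<close>; the points \<open>x s\<close> and \<open>x (- s)\<close> are symmetric about \<open>e\<close>.\<close>
  define x where "x s = sqrt (1 - s\<^sup>2) *\<^sub>R e + s *\<^sub>R v" for s :: real
  have x: "norm (x s) = 1" if "\<bar>s\<bar> \<le> 1" for s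
  proof -
    have "s\<^sup>2 \<le> 1" using that by (simp add: abs_square_le_1)
    then have "x s \<bullet> x s = 1"
      using e v by (simp add: x_def inner_add inner_commute norm_eq_1 power2_eq_square)
    then show ?thesis by (simp add: norm_eq_1)
  qed
  define D where "D s k = norm (x s - a k) powr lam + norm (x (- s) - a k) powr lam
      - 2 * norm (e - a k) powr lam" for s k
  have smooth: "\<exists>C. \<forall>s. 0 < s \<and> s < 1 \<longrightarrow> D s k \<ge> - C * s\<^sup>2" if k: "k \<in> K" for k
  proof (cases "a k = e")
    case True
    then show ?thesis by (intro exI[of _ 0]) (auto simp: D_def)
  next
    case False
    have b: "norm (a k) = 1" using a[OF k] by simp
    define t where "t y = 2 - 2 * (y \<bullet> a k)" for y
    have t: "norm (y - a k) powr lam = t y powr p" if "norm y = 1" for y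
      using norm_diff_unit_powr[OF that b, of lam] by (simp add: t_def p_def)
    have t_eq: "t y = (norm (y - a k))\<^sup>2" if "norm y = 1" for y
      using that b
      by (simp add: t_def power2_norm_eq_inner inner_diff inner_commute norm_eq_1)
    have t0: "t e > 0" using False e by (simp add: t_eq)
    show ?thesis
    proof (intro exI allI impI)
      fix s :: real assume s: "0 < s \<and> s < 1"
      define r where "r = 1 - sqrt (1 - s\<^sup>2)"
      have s2: "0 < s\<^sup>2" "s\<^sup>2 < 1" "s\<^sup>2 \<le> s"
        using s power_decreasing[of 1 2 s] by (simp_all add: abs_square_less_1)
      have "sqrt (1 - s\<^sup>2) \<ge> 1 - s\<^sup>2"
        using s2 by (intro real_le_rsqrt) (auto simp: power2_eq_square mult_left_le)
      moreover have "sqrt (1 - s\<^sup>2) \<le> 1" using s2 by simp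
      ultimately have r: "0 \<le> r" "r \<le> s\<^sup>2" by (auto simp: r_def)
      have al: "\<bar>e \<bullet> a k\<bar> \<le> 1" "\<bar>v \<bullet> a k\<bar> \<le> 1"
        using Cauchy_Schwarz_ineq2[of e "a k"] Cauchy_Schwarz_ineq2[of v "a k"] e v b by auto
      have tx: "t (x s) - t e = 2 * (r * (e \<bullet> a k)) - 2 * (s * (v \<bullet> a k))"
        "t (x (- s)) - t e = 2 * (r * (e \<bullet> a k)) + 2 * (s * (v \<bullet> a k))"
        by (auto simp: t_def x_def r_def inner_add_left algebra_simps)
      have re: "\<bar>r * (e \<bullet> a k)\<bar> \<le> s\<^sup>2"
        using mult_mono[of "\<bar>r\<bar>" "s\<^sup>2" "\<bar>e \<bullet> a k\<bar>" 1] r al by (simp add: abs_mult)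
      have sv: "\<bar>s * (v \<bullet> a k)\<bar> \<le> s"
        using mult_left_mono[OF al(2), of s] s by (simp add: abs_mult)
      have "t (x s) powr p + t (x (- s)) powr p - 2 * t e powr p
          \<ge> - (t e powr p * (4 / t e + 32 / (t e)\<^sup>2)) * s\<^sup>2"
      proof (rule powr_second_difference_ge[OF p t0])
        show "0 \<le> t (x s)" "0 \<le> t (x (- s))" using s x by (simp_all add: t_eq)
        show "\<bar>t (x s) - t e\<bar> \<le> 4 * s" "\<bar>t (x (- s)) - t e\<bar> \<le> 4 * s"
          unfolding tx using re sv s2 by linarith+
        have "t (x s) + t (x (- s)) - 2 * t e = 4 * (r * (e \<bullet> a k))" using tx by linarith
        then show "t (x s) + t (x (- s)) - 2 * t e \<ge> - 4 * s\<^sup>2" using re by linarith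
      qed
      then show "D s k \<ge> - (t e powr p * (4 / t e + 32 / (t e)\<^sup>2)) * s\<^sup>2"
        using s x e by (simp add: D_def t)
    qed
  qed
  then obtain C where C: "\<And>k s. \<lbrakk>k \<in> K; 0 < s; s < 1\<rbrakk> \<Longrightarrow> D s k \<ge> - C k * s\<^sup>2"
    by metis
  have cusp: "D s i0 \<ge> 2 * s powr lam" if s: "0 < s" "s < 1" for s
  proof -
    \<comment> \<open>The component of \<open>x t - e\<close> along \<open>v\<close> is \<open>t\<close>.\<close>
    have "norm (x t - e) \<ge> s" if "\<bar>t\<bar> = s" for t
    proof -
      have "s = \<bar>(x t - e) \<bullet> v\<bar>"
        using that v by (simp add: x_def inner_diff inner_add norm_eq_1)
      also have "\<dots> \<le> norm (x t - e)" using Cauchy_Schwarz_ineq2[of "x t - e" v] v by simp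
      finally show ?thesis .
    qed
    then have "norm (x t - e) powr lam \<ge> s powr lam" if "\<bar>t\<bar> = s" for t
      using that s lam by (intro powr_mono2) auto
    from this[of s] this[of "- s"] s show ?thesis by (simp add: D_def e_def[symmetric])
  qed
  define B where "B = (\<Sum>k\<in>K - {i0}. C k)"
  have key: "B * s powr (2 - lam) \<ge> 2" if s: "0 < s" "s < 1" for s
  proof -
    have "0 = (\<Sum>k\<in>K. D s k)"
      using c[OF x[of s]] c[OF x[of "- s"]] c[OF e] s
      by (simp add: D_def sum.distrib sum_subtractf flip: sum_distrib_left)
    also have "\<dots> = D s i0 + (\<Sum>k\<in>K - {i0}. D s k)"
      using fin by (simp add: sum.remove)
    also have "\<dots> \<ge> 2 * s powr lam + (\<Sum>k\<in>K - {i0}. - C k * s\<^sup>2)"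
      using cusp[OF s] C s by (intro add_mono sum_mono) auto
    also have "(\<Sum>k\<in>K - {i0}. - C k * s\<^sup>2) = - B * s\<^sup>2"
      by (simp add: B_def sum_distrib_right sum_negf)
    also have "s\<^sup>2 = s powr (2 - lam) * s powr lam"
      using s by (simp flip: powr_add powr_numeral)
    finally have "2 * s powr lam \<le> (B * s powr (2 - lam)) * s powr lam" by (simp add: mult_ac)
    then show ?thesis using s by (simp add: mult_le_cancel_right)
  qed
  have "((\<lambda>s. B * s powr (2 - lam)) \<longlongrightarrow> B * 0 powr (2 - lam)) (at_right 0)"
    using lam by (intro tendsto_intros) (auto simp: eventually_at_right_less intro: eventually_mono[OF eventually_at_right_less])
  moreover have "\<forall>\<^sub>F s in at_right 0. 2 \<le> B * s powr (2 - lam)"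
    using key by (auto simp: eventually_at_right_field intro!: exI[of _ 1])
  ultimately have "2 \<le> B * 0 powr (2 - lam)"
    by (intro tendsto_lowerbound) auto
  then show False by simp
qed

section \<open>Greedy sequences\<close>

lemma greedy_potential_Suc:
  "greedy_potential lam a (Suc n) x = greedy_potential lam a n x + norm (x - a n) powr lam"
  by (simp add: greedy_potential_def)

lemma greedy_potential_0 [simp]: "greedy_potential lam a 0 x = 0"
  by (simp add: greedy_potential_def)

lemma greedy_energy_sequenceD:
  assumes "greedy_energy_sequence lam a"
  shows "norm (a n) = 1"
    and "norm x = 1 \<Longrightarrow> greedy_potential lam a n x \<le> greedy_potential lam a n (a n)"
  using assms by (auto simp: greedy_energy_sequence_def) (cases "n = 0"; auto)

lemma greedy_potential_even:
  assumes "\<And>j. j < k \<Longrightarrow> a (2 * j + 1) = - a (2 * j)"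
  shows "greedy_potential lam a (2 * k) (- x) = greedy_potential lam a (2 * k) x"
  using assms
proof (induction k)
  case (Suc k)
  have "norm (- x - a (2 * k)) = norm (x + a (2 * k))" "norm (- x + a (2 * k)) = norm (x - a (2 * k))"
    by (metis minus_add_distrib diff_conv_add_uminus norm_minus_cancel)
      (metis minus_diff_eq norm_minus_cancel add.commute diff_conv_add_uminus)
  then show ?case
    using Suc.IH Suc.prems[of k] Suc.prems by (simp add: greedy_potential_Suc)
qed simp

lemma norm_diff_eq_2_imp_antipodal:
  fixes x y :: "'a::real_inner"
  assumes "norm x = 1" "norm y = 1" "norm (x - y) \<ge> 2"
  shows "x = - y"
proof -
  have "(norm (x + y))\<^sup>2 = 2 * (norm x)\<^sup>2 + 2 * (norm y)\<^sup>2 - (norm (x - y))\<^sup>2"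
    by (simp add: power2_norm_eq_inner inner_add inner_diff inner_commute)
  also have "\<dots> \<le> 0" using assms power_mono[of 2 "norm (x - y)" 2] by simp
  finally show ?thesis by (simp add: eq_neg_iff_add_eq_0)
qed

lemma norm_diff_unit_powr_le:
  fixes x y :: "'a::real_normed_vector"
  assumes "0 < lam" "norm x = 1" "norm y = 1"
  shows "norm (x - y) powr lam \<le> 2 powr lam"
  using assms norm_triangle_ineq4[of x y] by (intro powr_mono2) auto

text \<open>
When all earlier points are paired, evenness of \<open>U\<^sub>2\<^sub>k\<close> shows that the value at \<open>-a\<^sub>2\<^sub>k\<close> of the next
potential is already \<open>max U\<^sub>2\<^sub>k + 2\<^sup>\<lambda>\<close>.  No point \<open>x\<close> can do better, and equality forces
\<open>|x - a\<^sub>2\<^sub>k| = 2\<close>, that is \<open>x = -a\<^sub>2\<^sub>k\<close>.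
\<close>

lemma greedy_potential_odd_step:
  fixes a :: "nat \<Rightarrow> 'a::real_inner"
  assumes lam: "0 < lam" and greedy: "greedy_energy_sequence lam a"
  shows "a (2 * k + 1) = - a (2 * k)"
    and "greedy_potential lam a (2 * k + 1) (a (2 * k + 1))
      = greedy_potential lam a (2 * k) (a (2 * k)) + 2 powr lam"
proof -
  note unit = greedy_energy_sequenceD(1)[OF greedy] and max = greedy_energy_sequenceD(2)[OF greedy]
  define b c where "b k = a (2 * k)" and "c k = a (2 * k + 1)" for k
  have two: "norm (- b k - b k) = 2" for k
  proof -
    have "- b k - b k = (- 2) *\<^sub>R b k" by (simp add: scaleR_2)
    then show ?thesis using unit by (simp only: norm_scaleR) (simp add: b_def)
  qed
  have ge: "greedy_potential lam a (2 * k + 1) (c k)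
      \<ge> greedy_potential lam a (2 * k) (b k) + 2 powr lam"
    if "\<And>j. j < k \<Longrightarrow> a (2 * j + 1) = - a (2 * j)" for k
  proof -
    have "greedy_potential lam a (2 * k + 1) (c k) \<ge> greedy_potential lam a (2 * k + 1) (- b k)"
      unfolding c_def b_def using unit by (intro max) simp
    also have "greedy_potential lam a (2 * k + 1) (- b k)
        = greedy_potential lam a (2 * k) (b k) + norm (- b k - b k) powr lam"
      using greedy_potential_even[where lam = lam and a = a, OF that] by (simp add: greedy_potential_Suc b_def)
    finally show ?thesis unfolding two .
  qed
  have anti: "a (2 * k + 1) = - a (2 * k)" for k
  proof (induction k rule: less_induct)
    case (less k)
    have "greedy_potential lam a (2 * k + 1) (c k)
        = greedy_potential lam a (2 * k) (c k) + norm (c k - b k) powr lam"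
      by (simp add: greedy_potential_Suc b_def)
    moreover have "greedy_potential lam a (2 * k) (c k) \<le> greedy_potential lam a (2 * k) (b k)"
      unfolding b_def by (rule max) (simp add: c_def unit)
    ultimately have "2 powr lam \<le> norm (c k - b k) powr lam"
      using ge[of k, OF less.IH] by linarith
    then have "2 \<le> norm (c k - b k)"
      using lam by (metis norm_ge_zero not_le powr_less_mono2)
    then show ?case
      using norm_diff_eq_2_imp_antipodal[of "c k" "b k"] unit by (simp add: b_def c_def)
  qed
  show "a (2 * k + 1) = - a (2 * k)" by (rule anti)
  have "greedy_potential lam a (2 * k + 1) (c k)
      = greedy_potential lam a (2 * k) (- b k) + norm (- b k - b k) powr lam"
    using anti by (simp add: greedy_potential_Suc b_def c_def)
  then show "greedy_potential lam a (2 * k + 1) (a (2 * k + 1))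
      = greedy_potential lam a (2 * k) (a (2 * k)) + 2 powr lam"
    unfolding two using greedy_potential_even[of k a lam "b k"] anti by (simp add: b_def c_def)
qed

lemma greedy_potential_mono:
  assumes "greedy_energy_sequence lam a" "m \<le> n"
  shows "greedy_potential lam a m (a m) \<le> greedy_potential lam a n (a n)"
proof -
  have "incseq (\<lambda>n. greedy_potential lam a n (a n))"
  proof (intro incseq_SucI)
    fix n
    have "greedy_potential lam a n (a n) = greedy_potential lam a (Suc n) (a n)"
      by (simp add: greedy_potential_Suc)
    also have "\<dots> \<le> greedy_potential lam a (Suc n) (a (Suc n))"
      by (intro greedy_energy_sequenceD[OF assms(1)])
    finally show "greedy_potential lam a n (a n) \<le> greedy_potential lam a (Suc n) (a (Suc n))" .
  qed
  then show ?thesis using \<open>m \<le> n\<close> by (rule incseqD)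
qed

text \<open>
By monotonicity \<open>k u\<^sub>n\<close> is at most the sum of \<open>u\<close> over the window from \<open>n\<close> to \<open>n + k - 1\<close>, and that sum is
controlled by the upper bound for the partial sum up to \<open>n + k\<close> and the lower bound for the one up to \<open>n\<close>.
Dividing by \<open>k n\<close> leaves the errors \<open>I / (2k)\<close> and \<open>I k / (2n)\<close>, so \<open>k\<close> is chosen large first and \<open>n\<close>
afterwards.
\<close>

lemma mono_slope_tendsto:
  fixes u :: "nat \<Rightarrow> real"
  assumes mono: "\<And>m n. m \<le> n \<Longrightarrow> u m \<le> u n" and low: "\<And>n. real n * I \<le> u n"
    and up: "\<And>n. (\<Sum>m<n. u m) \<le> (real n)\<^sup>2 * I / 2"
  shows "(\<lambda>n. u n / real n) \<longlonglongrightarrow> I"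
proof -
  have half: "(\<Sum>m<n. real m * I) = real n * (real n - 1) / 2 * I" for n
    by (induction n) (auto simp: field_simps)
  have I: "I \<ge> 0" using low[of 0] up[of 1] by simp
  have window: "u n / real n \<le> I + I / (2 * real k) + I * real k / (2 * real n)"
    if "n > 0" "k > 0" for n k
  proof -
    have "real k * u n = (\<Sum>m\<in>{n..<n + k}. u n)" by simp
    also have "\<dots> \<le> (\<Sum>m\<in>{n..<n + k}. u m)" by (intro sum_mono mono) auto
    also have "\<dots> = (\<Sum>m<n + k. u m) - (\<Sum>m<n. u m)"
      by (simp add: sum_diff_nat_ivl lessThan_atLeast0)
    also have "\<dots> \<le> (real (n + k))\<^sup>2 * I / 2 - (\<Sum>m<n. real m * I)"
      by (intro diff_mono up sum_mono low)
    also have "\<dots> = real k * real n * (I + I / (2 * real k) + I * real k / (2 * real n))"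
      using that unfolding half by (simp add: field_simps power2_eq_square)
    finally show ?thesis using that by (simp add: divide_le_eq mult.assoc mult.commute)
  qed
  show ?thesis
  proof (rule LIMSEQ_I)
    fix r :: real assume r: "r > 0"
    obtain k where k: "real k > I / r" using reals_Archimedean2 by blast
    then have k0: "real k > 0" using I r by (meson divide_nonneg_pos le_less_trans)
    then have k1: "I / (2 * real k) < r / 2" using k r by (simp add: field_simps)
    obtain N where N: "real N > I * real k / r" using reals_Archimedean2 by blast
    show "\<exists>no. \<forall>n\<ge>no. norm (u n / real n - I) < r"
    proof (intro exI allI impI)
      fix n assume n: "n \<ge> Suc N"
      then have n0: "n > 0" by simp
      have "real n > I * real k / r" using N n by linarith
      then have "I * real k / (2 * real n) < r / 2" using r n0 by (simp add: field_simps)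
      moreover have "u n / real n \<ge> I" using low[of n] n0 by (simp add: field_simps)
      ultimately show "norm (u n / real n - I) < r"
        using window[of n k] n0 k0 k1 by simp
    qed
  qed
qed

text \<open>
Each pair of distinct indices is counted once on the right, in the potential of the point with the larger
index.
\<close>

lemma sum_pairwise_eq_twice_sum_greedy_potential:
  "(\<Sum>i<n. \<Sum>j<n. norm (a i - a j) powr lam) = 2 * (\<Sum>m<n. greedy_potential lam a m (a m))"
proof (induction n)
  case (Suc n)
  have "(\<Sum>i<n. norm (a i - a n) powr lam) = greedy_potential lam a n (a n)"
    by (simp add: greedy_potential_def norm_minus_commute)
  then show ?case
    using Suc by (simp add: sum.distrib) (simp add: greedy_potential_def)
qed simp

lemma integral_greedy_potential:
  fixes a :: "nat \<Rightarrow> real ^ 'n"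
  assumes "0 < lam" "\<And>k. a k \<in> sphere 0 1"
  shows "(\<integral>x. greedy_potential lam a n x \<partial>sphere_measure)
      = real n * riesz_energy lam (sphere_measure :: (real ^ 'n) measure)"
  unfolding greedy_potential_def
  by (subst Bochner_Integration.integral_sum)
    (use assms in \<open>auto simp: integral_norm_diff_powr_eq
      intro!: integrable_sphere_measure continuous_on_norm_diff_powr\<close>)

theorem theorem3p3:
  fixes d :: nat and lam :: real and a :: "nat \<Rightarrow> real ^ 'n"
    and U :: "nat \<Rightarrow> real ^ 'n \<Rightarrow> real" and I :: real
  assumes lam_range: "0 < lam" "lam < 2"
    and dim: "d \<ge> 1" "CARD('n) = d + 1"
    and greedy: "greedy_energy_sequence lam a"
  defines "U \<equiv> greedy_potential lam a"
    and "I \<equiv> riesz_energy lam (sphere_measure :: (real ^ 'n) measure)"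
  shows
    "(\<forall>n\<ge>1. U n (a n) \<le> U (n + 1) (a (n + 1)) \<and>
             U (n + 1) (a (n + 1)) \<le> U n (a n) + norm (a (n + 1) - a n) powr lam) \<and>
     (\<forall>n\<ge>1. \<not> U n constant_on sphere 0 1) \<and>
     (\<forall>n\<ge>1. real n * I < U n (a n) \<and> U n (a n) \<le> real n * 2 powr lam) \<and>
     (\<forall>k. U (2 * k + 1) (a (2 * k + 1)) = U (2 * k) (a (2 * k)) + 2 powr lam) \<and>
     ((\<lambda>n. U n (a n) / real n) \<longlonglongrightarrow> I)"
proof -
  have unit: "norm (a n) = 1" for n
    by (rule greedy_energy_sequenceD(1)[OF greedy])
  have max: "U n x \<le> U n (a n)" if "norm x = 1" for n x
    unfolding U_def by (rule greedy_energy_sequenceD(2)[OF greedy that])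
  have mono: "U m (a m) \<le> U n (a n)" if "m \<le> n" for m n
    unfolding U_def using that by (rule greedy_potential_mono[OF greedy])
  have step: "U (n + 1) (a (n + 1)) \<le> U n (a n) + norm (a (n + 1) - a n) powr lam" for n
    using max[OF unit, of n "n + 1"] by (simp add: U_def greedy_potential_Suc)
  have nonconst: "\<not> U n constant_on sphere 0 1" if "n \<ge> 1" for n
    using sum_norm_powr_not_constant_on_sphere[OF lam_range, of "{..<n}" 0 a] that dim unit
    by (simp add: U_def greedy_potential_def[abs_def])
  have lower: "real n * I < U n (a n)" if n: "n \<ge> 1" for n
  proof -
    have "\<exists>z\<in>sphere 0 1. U n z \<noteq> U n (a n)"
      using nonconst[OF n] unfolding constant_on_def by blast
    then obtain z where z: "norm z = 1" "U n z < U n (a n)"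
      using max[of _ n] by (force simp: less_le)
    have "continuous_on (sphere 0 1) (U n)"
      unfolding U_def greedy_potential_def[abs_def]
      by (intro continuous_on_sum continuous_on_norm_diff_powr lam_range)
    then have "(\<integral>x. U n x \<partial>sphere_measure) < U n (a n)"
      using max z by (intro integral_sphere_measure_less[where z = z]) auto
    then show ?thesis
      using integral_greedy_potential[of lam a n] lam_range unit by (simp add: U_def I_def)
  qed
  have upper: "U n (a n) \<le> real n * 2 powr lam" for n
    using sum_mono[of "{..<n}" "\<lambda>k. norm (a n - a k) powr lam" "\<lambda>_. 2 powr lam"]
      norm_diff_unit_powr_le[OF lam_range(1) unit unit]
    by (simp add: U_def greedy_potential_def)
  have odd: "U (2 * k + 1) (a (2 * k + 1)) = U (2 * k) (a (2 * k)) + 2 powr lam" for k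
    unfolding U_def by (rule greedy_potential_odd_step(2)[OF lam_range(1) greedy])
  have "(\<lambda>n. U n (a n) / real n) \<longlonglongrightarrow> I"
  proof (rule mono_slope_tendsto)
    show "real n * I \<le> U n (a n)" for n
      using lower[of n] by (cases "n = 0") (auto simp: U_def)
    show "(\<Sum>m<n. U m (a m)) \<le> (real n)\<^sup>2 * I / 2" for n
      using sum_norm_diff_powr_le_energy[OF lam_range, of a n] unit
      by (simp add: sum_pairwise_eq_twice_sum_greedy_potential U_def I_def)
  qed (rule mono)
  with mono step nonconst lower upper odd show ?thesis by simp
qed

end
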